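(* Let $p$ be a prime and consider the recurrence $\tau_{n+5}\tau_n=\tau_{n+4}\tau_{n+1}+\tau_{n+3}\tau_{n+2}$ with an initial value problem that is well-balanced mod $p$. Then the rational Somos-5 sequence $(\tau_n)_{n\in\mathbb{Z}}$ determined by these initial values is defined for all $n\in\mathbb{Z}$, and so is the reduced sequence $(\tau_n \bmod p)_{n\in\mathbb{Z}}$ (that is, every $\tau_n$ is a $p$-adic integer, $|\tau_n|_p\le1$); moreover the sequence $(\tau_n \bmod p)$ is periodic in $n$.
   Context: Definition (well-balanced): for a prime $p$, an initial value problem for $\tau_{n+5}\tau_n=\tau_{n+4}\tau_{n+1}+\tau_{n+3}\tau_{n+2}$ over $\mathbb{Q}$ is well-balanced mod $p$ if it is specified by either $(\tau_0,\tau_1,\tau_2,\tau_3,\tau_4)\in\mathbb{Q}^5$ or $(\tau_1,\tau_2,\tau_3,\tau_4,\tau_5)\in\mathbb{Q}^5$ such that $|\tau_1|_p=|\tau_2|_p=|\tau_3|_p=|\tau_4|_p=1$ and $|\tau_4\tau_1+\tau_3\tau_2|_p\le|\tau_*|_p\le1$ with $\tau_*\neq0$, where $\tau_*=\tau_0$ or $\tau_5$ accordingly; $|\cdot|_p$ is the $p$-adic absolute value. The recurrence has the Laurent property: for each $m\in\mathbb{Z}$ the term $\tau_{m}$ is given by a Laurent polynomial with integer coefficients in any five consecutive terms; the sequence determined by five nonzero initial values is understood as the values of these Laurent polynomials evaluated at the initial values (this continues the sequence past any zero terms), and this sequence satisfies the recurrence for all $n$. *)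

theory Defs
  imports
    Complex_Main
    "HOL-Library.Poly_Mapping"
    "HOL-Library.Numeral_Type"
    "HOL-Number_Theory.Number_Theory"
begin

definition padic_abs :: "nat \<Rightarrow> rat \<Rightarrow> real" where
  "padic_abs p x =
     (if x = 0 then 0
      else real p powi (int (multiplicity (int p) (snd (quotient_of x)))
                      - int (multiplicity (int p) (fst (quotient_of x)))))"

text \<open>
  The reduction map from the rationals with \<open>padic_abs p x \<le> 1\<close> onto the field with \<open>p\<close>
  elements, the latter represented by \<open>{0..<p}\<close>. Outside this domain the value is meaningless.
\<close>
definition padic_reduce :: "nat \<Rightarrow> rat \<Rightarrow> int" where
  "padic_reduce p x =
     (fst (quotient_of x) * modular_inverse (int p) (snd (quotient_of x))) mod int p"

text \<open>
  Laurent polynomials with integer coefficients in five variables: the keys of type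
  \<open>5 \<Rightarrow>\<^sub>0 int\<close> are the exponent vectors (negative exponents allowed), the values are the
  coefficients, and the multiplication of \<^type>\<open>poly_mapping\<close> is the usual convolution product.
\<close>
type_synonym laurent5 = "(5 \<Rightarrow>\<^sub>0 int) \<Rightarrow>\<^sub>0 int"

definition lvar :: "5 \<Rightarrow> laurent5" where
  "lvar i = Poly_Mapping.single (Poly_Mapping.single i 1) 1"

definition leval :: "(5 \<Rightarrow> rat) \<Rightarrow> laurent5 \<Rightarrow> rat" where
  "leval v L =
     (\<Sum>m\<in>Poly_Mapping.keys L. of_int (Poly_Mapping.lookup L m) *
        (\<Prod>i\<in>UNIV. v i powi Poly_Mapping.lookup m i))"

definition somos5_rec :: "(int \<Rightarrow> 'a::comm_ring_1) \<Rightarrow> bool" where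
  "somos5_rec \<tau> \<longleftrightarrow>
     (\<forall>n. \<tau> (n + 5) * \<tau> n = \<tau> (n + 4) * \<tau> (n + 1) + \<tau> (n + 3) * \<tau> (n + 2))"

definition has_initial_values :: "(int \<Rightarrow> 'a) \<Rightarrow> int \<Rightarrow> (5 \<Rightarrow> 'a) \<Rightarrow> bool" where
  "has_initial_values \<tau> s v \<longleftrightarrow>
     \<tau> s = v 0 \<and> \<tau> (s + 1) = v 1 \<and> \<tau> (s + 2) = v 2 \<and> \<tau> (s + 3) = v 3 \<and> \<tau> (s + 4) = v 4"

text \<open>
  The sequence of Laurent polynomials expressing the terms of a Somos-5 sequence through the five
  consecutive terms with indices \<open>0, \<dots>, 4\<close>. Existence and uniqueness of such a
  sequence is the Laurent property.
\<close>
definition is_somos5_laurent :: "(int \<Rightarrow> laurent5) \<Rightarrow> bool" where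
  "is_somos5_laurent T \<longleftrightarrow> somos5_rec T \<and> has_initial_values T 0 lvar"

definition somos5_laurent :: "int \<Rightarrow> laurent5" where
  "somos5_laurent = (THE T. is_somos5_laurent T)"

text \<open>
  The rational sequence determined by the five nonzero initial values
  \<open>\<tau>\<^sub>s = v 0, \<dots>, \<tau>\<^bsub>s+4\<^esub> = v 4\<close>. Evaluating the Laurent polynomials continues it past zero
  terms; the recurrence is invariant under shifts of the index, hence the argument \<open>n - s\<close>.
\<close>
definition somos5 :: "int \<Rightarrow> (5 \<Rightarrow> rat) \<Rightarrow> int \<Rightarrow> rat" where
  "somos5 s v n = leval v (somos5_laurent (n - s))"

definition balanced_values :: "nat \<Rightarrow> rat \<Rightarrow> rat \<Rightarrow> rat \<Rightarrow> rat \<Rightarrow> rat \<Rightarrow> bool" where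
  "balanced_values p t1 t2 t3 t4 t \<longleftrightarrow>
     padic_abs p t1 = 1 \<and> padic_abs p t2 = 1 \<and> padic_abs p t3 = 1 \<and> padic_abs p t4 = 1 \<and>
     padic_abs p (t4 * t1 + t3 * t2) \<le> padic_abs p t \<and> padic_abs p t \<le> 1 \<and> t \<noteq> 0"

text \<open>
  The initial value problem prescribes \<open>\<tau>\<^bsub>s+i\<^esub> = v i\<close>, so for \<open>s = 0\<close> the distinguished value is
  \<open>\<tau>\<^sub>0 = v 0\<close>, and for \<open>s = 1\<close> it is \<open>\<tau>\<^sub>5 = v 4\<close>.
\<close>
definition well_balanced :: "nat \<Rightarrow> int \<Rightarrow> (5 \<Rightarrow> rat) \<Rightarrow> bool" where
  "well_balanced p s v \<longleftrightarrow>
     s = 0 \<and> balanced_values p (v 1) (v 2) (v 3) (v 4) (v 0) \<or>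
     s = 1 \<and> balanced_values p (v 0) (v 1) (v 2) (v 3) (v 4)"

end

theory Submission
  imports Defs "HOL-Computational_Algebra.Fraction_Field"
begin

text \<open>
  Everything rests on windows \<open>\<tau>\<^sub>n, \<dots>, \<tau>\<^bsub>n+5\<^esub>\<close> whose four inner terms are units while the two outer
  ones are merely integral. If \<open>\<tau>\<^bsub>n+5\<^esub>\<close> is a unit the window moves on by one step. If \<open>\<tau>\<^bsub>n+5\<^esub>\<close> lies in a
  maximal ideal, then modulo that ideal the terms \<open>\<tau>\<^bsub>n+6\<^esub>, \<dots>, \<tau>\<^bsub>n+9\<^esub>\<close> are products of units, and the
  relation \<open>\<tau>\<^bsub>n+5\<^esub> \<tau>\<^sub>n = \<tau>\<^bsub>n+4\<^esub> \<tau>\<^bsub>n+1\<^esub> + \<tau>\<^bsub>n+3\<^esub> \<tau>\<^bsub>n+2\<^esub>\<close> makes the numerator of \<open>\<tau>\<^bsub>n+10\<^esub>\<close> divisible by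
  \<open>\<tau>\<^bsub>n+5\<^esub>\<close>, so that the window jumps by five steps.

  Over the Laurent polynomial ring this local argument is made global by the comaximality of \<open>\<tau>\<^sub>5\<close> and
  \<open>\<tau>\<^sub>6 \<tau>\<^sub>7 \<tau>\<^sub>8 \<tau>\<^sub>9\<close>, and gives the Laurent property. Modulo \<open>p\<close> it shows that all terms are integral
  and that the residues of one window determine those of all terms, in both directions since the
  recurrence is reversible; some residue window recurs because there are only finitely many.
\<close>

section \<open>Jumping over one term\<close>

text \<open>
  The numerator of the tenth term over \<open>x1\<^sup>3 x2\<^sup>2 x3 x4\<close> after the factor \<open>x5\<close> has been cancelled. Here
  \<open>nk\<close> is the numerator of the \<open>k\<close>th term, and \<open>bk\<close> is the quotient of \<open>nk\<close> minus its value at \<open>x5 = 0\<close>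
  by \<open>x5\<close>.
\<close>

definition somos5_jump :: "'a::comm_ring_1 \<Rightarrow> 'a \<Rightarrow> 'a \<Rightarrow> 'a \<Rightarrow> 'a \<Rightarrow> 'a \<Rightarrow> 'a" where
  "somos5_jump x0 x1 x2 x3 x4 x5 =
    (let n6 = x5 * x2 + x4 * x3;
         b7 = x2 * x3 + x1 * x4;
         n7 = x4 * x3 * x3 + x5 * b7;
         b8 = b7 * x4 + x2 * n6;
         n8 = x4 * x4 * x3 * x3 + x5 * b8;
         b9 = x1 * n8 + x3 * (b7 * n6 + x4 * x3 * x3 * x2)
     in x3 * x3 * x3 * x3 * x4 * x4 * x4 * x0
        + x2 * (b9 * n6 + x3 * x3 * x3 * x3 * x4 * x4 * x2)
        + x1 * x4 * (b8 * n7 + x4 * x4 * x3 * x3 * b7))"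

text \<open>Clearing denominators turns \<open>x6\<close> to \<open>x9\<close> into polynomials
  \<open>n6\<close> to \<open>n9\<close> in \<open>x1\<close> to \<open>x5\<close>. The part of the
  numerator of \<open>x10 * x5\<close> that survives at \<open>x5 = 0\<close> contains the factor
  \<open>x4 * x1 + x3 * x2\<close>, which by \<open>e0\<close> is \<open>x5 * x0\<close>. So
  \<open>x5\<close> cancels, and \<open>x0\<close> enters exactly here. An integral domain suffices,
  so the identity serves both fields and Laurent polynomials.\<close>

lemma somos5_jump_eq:
  fixes x0 :: "'a::idom"
  assumes e0: "x5 * x0 = x4 * x1 + x3 * x2" and e1: "x6 * x1 = x5 * x2 + x4 * x3"
    and e2: "x7 * x2 = x6 * x3 + x5 * x4" and e3: "x8 * x3 = x7 * x4 + x6 * x5"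
    and e4: "x9 * x4 = x8 * x5 + x7 * x6" and e5: "x10 * x5 = x9 * x6 + x8 * x7"
    and nz: "x5 \<noteq> 0"
  shows "x1 * x1 * x1 * x2 * x2 * x3 * x4 * x10 = somos5_jump x0 x1 x2 x3 x4 x5"
proof -
  define n6 where "n6 = x5 * x2 + x4 * x3"
  define b7 where "b7 = x2 * x3 + x1 * x4"
  define n7 where "n7 = x4 * x3 * x3 + x5 * b7"
  define b8 where "b8 = b7 * x4 + x2 * n6"
  define n8 where "n8 = x4 * x4 * x3 * x3 + x5 * b8"
  define b9 where "b9 = x1 * n8 + x3 * (b7 * n6 + x4 * x3 * x3 * x2)"
  define n9 where "n9 = x3 * x3 * x3 * x3 * x4 * x4 + x5 * b9"
  have h6: "x1 * x6 = n6" using e1 by (simp add: n6_def mult.commute)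
  have "x1 * x2 * x7 = x1 * (x7 * x2)" by (simp add: mult_ac)
  also have "\<dots> = n6 * x3 + x1 * x5 * x4" unfolding e2 h6[symmetric] by (simp add: algebra_simps)
  also have "\<dots> = n7" unfolding n7_def n6_def b7_def by (simp add: algebra_simps)
  finally have h7: "x1 * x2 * x7 = n7" .
  have "x1 * x2 * x3 * x8 = x1 * x2 * (x8 * x3)" by (simp add: mult_ac)
  also have "\<dots> = n7 * x4 + x2 * n6 * x5"
    unfolding e3 h7[symmetric] h6[symmetric] by (simp add: algebra_simps)
  also have "\<dots> = n8" unfolding n8_def n7_def b8_def by (simp add: algebra_simps)
  finally have h8: "x1 * x2 * x3 * x8 = n8" .
  have "x1 * x1 * x2 * x3 * x4 * x9 = x1 * x1 * x2 * x3 * (x9 * x4)" by (simp add: mult_ac)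
  also have "\<dots> = x1 * n8 * x5 + x3 * n7 * n6"
    unfolding e4 h8[symmetric] h7[symmetric] h6[symmetric] by (simp add: algebra_simps)
  also have "\<dots> = n9" unfolding n9_def n7_def b9_def n6_def by (simp add: algebra_simps)
  finally have h9: "x1 * x1 * x2 * x3 * x4 * x9 = n9" .
  have "x5 * (x1 * x1 * x1 * x2 * x2 * x3 * x4 * x10)
      = x1 * x1 * x1 * x2 * x2 * x3 * x4 * (x10 * x5)" by (simp add: mult_ac)
  also have "\<dots> = x2 * n9 * n6 + x1 * x4 * n8 * n7"
    unfolding e5 h9[symmetric] h8[symmetric] h7[symmetric] h6[symmetric]
    by (simp add: algebra_simps)
  also have "\<dots> = x3 * x3 * x3 * x3 * x4 * x4 * x4 * (x4 * x1 + x3 * x2)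
       + x5 * (x2 * (b9 * n6 + x3 * x3 * x3 * x3 * x4 * x4 * x2)
        + x1 * x4 * (b8 * n7 + x4 * x4 * x3 * x3 * b7))"
    unfolding n9_def n8_def n7_def n6_def by (simp add: algebra_simps)
  also have "\<dots> = x5 * somos5_jump x0 x1 x2 x3 x4 x5"
    unfolding somos5_jump_def Let_def e0[symmetric]
      n6_def[symmetric] b7_def[symmetric] n7_def[symmetric] b8_def[symmetric] n8_def[symmetric]
      b9_def[symmetric]
    by (simp add: algebra_simps)
  finally show ?thesis using nz by simp
qed


section \<open>Integrality over a subring of a field\<close>

definition is_subring :: "'a::field set \<Rightarrow> bool" where
  "is_subring A \<longleftrightarrow> 1 \<in> A \<and> (\<forall>a\<in>A. \<forall>b\<in>A. a + b \<in> A \<and> a * b \<in> A \<and> - a \<in> A)"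

lemma
  assumes "is_subring A"
  shows is_subring_1: "1 \<in> A"
    and is_subring_add: "a \<in> A \<Longrightarrow> b \<in> A \<Longrightarrow> a + b \<in> A"
    and is_subring_mult: "a \<in> A \<Longrightarrow> b \<in> A \<Longrightarrow> a * b \<in> A"
    and is_subring_uminus: "a \<in> A \<Longrightarrow> - a \<in> A"
  using assms unfolding is_subring_def by blast+

lemma is_subring_diff: "is_subring A \<Longrightarrow> a \<in> A \<Longrightarrow> b \<in> A \<Longrightarrow> a - b \<in> A"
  using is_subring_add[of A a "- b"] is_subring_uminus by force

lemma is_subring_power: "is_subring A \<Longrightarrow> a \<in> A \<Longrightarrow> a ^ k \<in> A"
  by (induction k) (auto simp: is_subring_1 is_subring_mult)

text \<open>For nonzero \<open>s\<close> this is A[1/s], realized inside the ambient field so that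
  different localizations can be intersected.\<close>

definition localization :: "'a::field set \<Rightarrow> 'a \<Rightarrow> 'a set" where
  "localization A s = {x. \<exists>k. s ^ k * x \<in> A}"

lemma is_subring_localization:
  assumes A: "is_subring A" and s: "s \<in> A"
  shows "is_subring (localization A s)"
  unfolding is_subring_def
proof (intro conjI ballI)
  show "1 \<in> localization A s"
    unfolding localization_def by (auto intro!: exI[of _ 0] simp: is_subring_1[OF A])
  fix a b assume "a \<in> localization A s" "b \<in> localization A s"
  then obtain k l where k: "s ^ k * a \<in> A" and l: "s ^ l * b \<in> A"
    unfolding localization_def by blast
  have pw: "s ^ i \<in> A" for i using is_subring_power[OF A s] .
  have "s ^ (k + l) * (a + b) = s ^ l * (s ^ k * a) + s ^ k * (s ^ l * b)"
    by (simp add: power_add algebra_simps)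
  then show "a + b \<in> localization A s"
    unfolding localization_def using k l pw is_subring_add[OF A] is_subring_mult[OF A]
    by (metis (mono_tags, lifting) mem_Collect_eq)
  have "s ^ (k + l) * (a * b) = (s ^ k * a) * (s ^ l * b)"
    by (simp add: power_add algebra_simps)
  then show "a * b \<in> localization A s"
    unfolding localization_def using k l is_subring_mult[OF A]
    by (metis (mono_tags, lifting) mem_Collect_eq)
  show "- a \<in> localization A s"
    unfolding localization_def using k is_subring_uminus[OF A] by force
qed

lemma subset_localization: "a \<in> A \<Longrightarrow> a \<in> localization A s"
  unfolding localization_def by (auto intro!: exI[of _ 0])

lemma inverse_mem_localization:
  assumes "is_subring A" "s \<noteq> 0"
  shows "inverse s \<in> localization A s"
  unfolding localization_def using assms by (auto intro!: exI[of _ 1] simp: is_subring_1)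

text \<open>The cosets modulo \<open>y\<close> of genuine units of \<open>A\<close>. Such an element
  is comaximal with \<open>y\<close>, and this form is inherited by products, hence by
  powers.\<close>

definition units_mod :: "'a::field set \<Rightarrow> 'a \<Rightarrow> 'a set" where
  "units_mod A y = {x. \<exists>u w. u \<in> A \<and> inverse u \<in> A \<and> u \<noteq> 0 \<and> w \<in> A \<and> x = u + y * w}"

lemma units_modI:
  assumes "u \<in> A" "inverse u \<in> A" "u \<noteq> 0" "w \<in> A"
  shows "u + y * w \<in> units_mod A y"
  unfolding units_mod_def using assms by blast

lemma units_mod_mult:
  assumes A: "is_subring A" and y: "y \<in> A" and x: "x \<in> units_mod A y" "x' \<in> units_mod A y"
  shows "x * x' \<in> units_mod A y"
proof -
  obtain u w u' w' where h: "u \<in> A" "inverse u \<in> A" "u \<noteq> 0" "w \<in> A" "x = u + y * w"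
    "u' \<in> A" "inverse u' \<in> A" "u' \<noteq> 0" "w' \<in> A" "x' = u' + y * w'"
    using x unfolding units_mod_def by blast
  have "x * x' = u * u' + y * (u * w' + w * u' + y * w * w')"
    using h by (simp add: algebra_simps)
  moreover have "u * u' + y * (u * w' + w * u' + y * w * w') \<in> units_mod A y"
    using h y by (intro units_modI) (auto intro!: is_subring_mult[OF A] is_subring_add[OF A])
  ultimately show ?thesis by simp
qed

lemma units_mod_power:
  assumes "is_subring A" "y \<in> A" "x \<in> units_mod A y"
  shows "x ^ k \<in> units_mod A y"
proof (induction k)
  case 0
  show ?case
    using units_modI[of 1 A 0 y] is_subring_1[OF assms(1)] is_subring_diff[OF assms(1), of 1 1]
    by simp
next
  case (Suc k)
  then show ?case using units_mod_mult[OF assms(1,2)] assms(3) by simp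
qed

lemma units_mod_add:
  assumes A: "is_subring A" and x: "x \<in> units_mod A y" and w: "w \<in> A"
  shows "x + y * w \<in> units_mod A y"
proof -
  obtain u w' where h: "u \<in> A" "inverse u \<in> A" "u \<noteq> 0" "w' \<in> A" "x = u + y * w'"
    using x unfolding units_mod_def by blast
  have "x + y * w = u + y * (w' + w)" using h by (simp add: algebra_simps)
  moreover have "u + y * (w' + w) \<in> units_mod A y"
    using h w by (intro units_modI is_subring_add[OF A])
  ultimately show ?thesis by simp
qed

text \<open>Writing a power of \<open>s\<close> as \<open>u + y * w\<close> with a unit
  \<open>u\<close> expresses \<open>y ^ k * z\<close> through \<open>s ^ l * z\<close> and
  \<open>y ^ Suc k * z\<close>. The exponent of \<open>y\<close> therefore descends to 0.\<close>

lemma comaximal_localizations: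
  assumes A: "is_subring A" and y: "y \<in> A" and s: "s \<in> units_mod A y"
    and z: "z \<in> localization A y" "z \<in> localization A s"
  shows "z \<in> A"
proof -
  obtain k l where k: "y ^ k * z \<in> A" and l: "s ^ l * z \<in> A"
    using z unfolding localization_def by blast
  obtain u w where h: "u \<in> A" "inverse u \<in> A" "u \<noteq> 0" "w \<in> A" "s ^ l = u + y * w"
    using units_mod_power[OF A y s, of l] unfolding units_mod_def by blast
  show ?thesis using k
  proof (induction k)
    case 0
    then show ?case by simp
  next
    case (Suc k)
    have "y ^ k * z = inverse u * (y ^ k * (s ^ l * z) - w * (y ^ Suc k * z))"
      unfolding h(5) using h(3) by (simp add: algebra_simps)
    also have "\<dots> \<in> A"
      by (intro is_subring_mult[OF A _ is_subring_diff[OF A]]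
            is_subring_mult[OF A _ l] is_subring_mult[OF A _ Suc.prems] is_subring_power[OF A y] h)
    finally show ?case by (rule Suc.IH)
  qed
qed

text \<open>Strong induction on the index, for all sequences and subrings at once. Inverting
  \<open>x 5\<close> allows a shift by one, and inverting \<open>x 6\<close> to \<open>x 9\<close>
  allows a shift by five. Each puts the term into a localization of \<open>A\<close>, and
  comaximality brings it back to \<open>A\<close>.\<close>

lemma somos5_mem_subring:
  fixes x :: "nat \<Rightarrow> 'a::field"
  assumes "\<And>n. x (n + 5) * x n = x (n + 4) * x (n + 1) + x (n + 3) * x (n + 2)"
    and "\<And>n. x n \<noteq> 0"
    and "is_subring A" and "\<And>i. i \<le> 5 \<Longrightarrow> x i \<in> A"
    and "\<And>i. 1 \<le> i \<Longrightarrow> i \<le> 4 \<Longrightarrow> inverse (x i) \<in> A"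
  shows "x n \<in> A"
  using assms
proof (induction n arbitrary: x A rule: less_induct)
  case (less n)
  note rec = less.prems(1) and nz = less.prems(2) and A = less.prems(3)
    and mem = less.prems(4) and inv = less.prems(5)
  note mult = is_subring_mult[OF A] and add = is_subring_add[OF A]
  have r: "x 5 * x 0 = x 4 * x 1 + x 3 * x 2" "x 6 * x 1 = x 5 * x 2 + x 4 * x 3"
    "x 7 * x 2 = x 6 * x 3 + x 5 * x 4" "x 8 * x 3 = x 7 * x 4 + x 6 * x 5"
    "x 9 * x 4 = x 8 * x 5 + x 7 * x 6" "x 10 * x 5 = x 9 * x 6 + x 8 * x 7"
    using rec[of 0] rec[of 1] rec[of 2] rec[of 3] rec[of 4] rec[of 5]
    by (simp_all add: eval_nat_numeral)
  have x: "x i \<in> A" if "i \<in> {0,1,2,3,4,5}" for i using that by (intro mem) auto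
  have y: "inverse (x i) \<in> A" if "i \<in> {1,2,3,4}" for i using that by (intro inv) auto
  have u: "x i \<in> units_mod A (x 5)" "inverse (x i) \<in> units_mod A (x 5)" if "i \<in> {1,2,3,4}" for i
    using units_modI[of "x i" A 0 "x 5"] units_modI[of "inverse (x i)" A 0 "x 5"]
      x[of i] y[of i] that nz[of i] is_subring_diff[OF A, of 1 1] is_subring_1[OF A] by auto
  \<comment> \<open>In \<open>e6\<close> to \<open>e9\<close> the multiple of \<open>x 5\<close> is
    split off. The same equations then yield membership in \<open>A\<close> and, since the first
    summand is a product of units modulo \<open>x 5\<close>, membership in
    \<open>units_mod A (x 5)\<close>.\<close>
  have e6: "x 6 = x 4 * x 3 * inverse (x 1) + x 5 * (x 2 * inverse (x 1))"
    using r nz[of 1] by (simp add: field_simps)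
  have e7: "x 7 = x 6 * x 3 * inverse (x 2) + x 5 * (x 4 * inverse (x 2))"
    using r nz[of 2] by (simp add: field_simps)
  have e8: "x 8 = x 7 * x 4 * inverse (x 3) + x 5 * (x 6 * inverse (x 3))"
    using r nz[of 3] by (simp add: field_simps)
  have e9: "x 9 = x 7 * x 6 * inverse (x 4) + x 5 * (x 8 * inverse (x 4))"
    using r nz[of 4] by (simp add: field_simps)
  \<comment> \<open>The recurrence would divide by \<open>x 5\<close>, which need not be invertible
    in \<open>A\<close>. The jump identity divides only by \<open>x 1\<close> to
    \<open>x 4\<close>.\<close>
  have e10: "x 10 = somos5_jump (x 0) (x 1) (x 2) (x 3) (x 4) (x 5) *
      (inverse (x 1) * inverse (x 1) * inverse (x 1) * inverse (x 2) * inverse (x 2) *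
       inverse (x 3) * inverse (x 4))"
  proof -
    have "somos5_jump (x 0) (x 1) (x 2) (x 3) (x 4) (x 5) =
        x 1 * x 1 * x 1 * x 2 * x 2 * x 3 * x 4 * x 10"
      by (rule somos5_jump_eq[symmetric, of _ _ _ _ _ _ "x 6" "x 7" "x 8" "x 9"])
        (use r nz[of 5] in simp_all)
    then show ?thesis using nz[of 1] nz[of 2] nz[of 3] nz[of 4] by (simp add: field_simps)
  qed
  have m6: "x 6 \<in> A" unfolding e6 by (intro mult add x y) auto
  have m7: "x 7 \<in> A" unfolding e7 by (intro mult add x y m6) auto
  have m8: "x 8 \<in> A" unfolding e8 by (intro mult add x y m6 m7) auto
  have m9: "x 9 \<in> A" unfolding e9 by (intro mult add x y m6 m7 m8) auto
  have m10: "x 10 \<in> A" unfolding e10 somos5_jump_def Let_def by (intro mult add x y) auto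
  note umult = units_mod_mult[OF A x] and uadd = units_mod_add[OF A]
  have u6: "x 6 \<in> units_mod A (x 5)" unfolding e6 by (intro umult uadd u mult x y) auto
  have u7: "x 7 \<in> units_mod A (x 5)" unfolding e7 by (intro umult uadd u mult x y u6) auto
  have u8: "x 8 \<in> units_mod A (x 5)" unfolding e8 by (intro umult uadd u mult x y m6 u7) auto
  have u9: "x 9 \<in> units_mod A (x 5)" unfolding e9 by (intro umult uadd u mult x y u6 u7 m8) auto
  \<comment> \<open>Inverting this one product inverts all four inner terms of the window from
    \<open>x 5\<close> to \<open>x 10\<close>.\<close>
  define s where "s = x 6 * x 7 * x 8 * x 9"
  have sA: "s \<in> A" unfolding s_def by (intro mult m6 m7 m8 m9)
  have s_unit: "s \<in> units_mod A (x 5)" unfolding s_def by (intro umult u6 u7 u8 u9) auto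
  have s0: "s \<noteq> 0" unfolding s_def using nz by simp
  consider "n \<le> 5" | "n = 6" | "n = 7" | "n = 8" | "n = 9" | "10 \<le> n" by linarith
  then show ?case
  proof cases
    case 1
    then show ?thesis using mem by simp
  next
    case 6
    have "x n \<in> localization A (x 5)"
    proof -
      have "x (n - 1 + 1) \<in> localization A (x 5)"
      proof (rule less.IH[of "n - 1" "\<lambda>i. x (i + 1)"])
        show "n - 1 < n" using 6 by simp
        show "x (i + 5 + 1) * x (i + 1) = x (i + 4 + 1) * x (i + 1 + 1) + x (i + 3 + 1) * x (i + 2 + 1)"
          for i using rec[of "i + 1"] by (simp add: add.commute add.left_commute)
        show "is_subring (localization A (x 5))" using is_subring_localization[OF A x[of 5]] by simp
        show "x (i + 1) \<in> localization A (x 5)" if "i \<le> 5" for i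
          using subset_localization mem[of "i + 1"] m6 that by (cases "i = 5") auto
        show "inverse (x (i + 1)) \<in> localization A (x 5)" if "1 \<le> i" "i \<le> 4" for i
          using subset_localization inv[of "i + 1"] inverse_mem_localization[OF A nz[of 5]] that
          by (cases "i = 4") auto
      qed (rule nz)
      then show ?thesis using 6 by simp
    qed
    moreover have "x n \<in> localization A s"
    proof -
      have L: "is_subring (localization A s)" by (rule is_subring_localization[OF A sA])
      have iv: "inverse (x 6) \<in> localization A s \<and> inverse (x 7) \<in> localization A s \<and>
          inverse (x 8) \<in> localization A s \<and> inverse (x 9) \<in> localization A s"
      proof -
        have "inverse (x 6) = inverse s * (x 7 * x 8 * x 9)"
          "inverse (x 7) = inverse s * (x 6 * x 8 * x 9)"
          "inverse (x 8) = inverse s * (x 6 * x 7 * x 9)"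
          "inverse (x 9) = inverse s * (x 6 * x 7 * x 8)"
          using nz[of 6] nz[of 7] nz[of 8] nz[of 9] unfolding s_def by (simp_all add: field_simps)
        moreover have "inverse s * (a * b * c) \<in> localization A s"
          if "a \<in> A" "b \<in> A" "c \<in> A" for a b c
          by (intro is_subring_mult[OF L] inverse_mem_localization[OF A s0] subset_localization that)
        ultimately show ?thesis using m6 m7 m8 m9 by simp
      qed
      have "x (n - 5 + 5) \<in> localization A s"
      proof (rule less.IH[of "n - 5" "\<lambda>i. x (i + 5)"])
        show "n - 5 < n" using 6 by simp
        show "x (i + 5 + 5) * x (i + 5) = x (i + 4 + 5) * x (i + 1 + 5) + x (i + 3 + 5) * x (i + 2 + 5)"
          for i using rec[of "i + 5"] by (simp add: add.commute add.left_commute)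
        show "x (i + 5) \<in> localization A s" if "i \<le> 5" for i
        proof -
          have "i \<in> {0,1,2,3,4,5}" using that by auto
          then show ?thesis using subset_localization x[of 5] m6 m7 m8 m9 m10 by auto
        qed
        show "inverse (x (i + 5)) \<in> localization A s" if "1 \<le> i" "i \<le> 4" for i
        proof -
          have "i \<in> {1,2,3,4}" using that by auto
          then show ?thesis using iv by auto
        qed
      qed (rule nz L)+
      then show ?thesis using 6 by simp
    qed
    ultimately show ?thesis using comaximal_localizations[OF A x s_unit] by simp
  qed (use m6 m7 m8 m9 in simp_all)
qed

section \<open>The Laurent property\<close>

lemma leval_superset:
  assumes "finite S" "Poly_Mapping.keys L \<subseteq> S"
  shows "leval v L = (\<Sum>m\<in>S. of_int (Poly_Mapping.lookup L m) *
    (\<Prod>i\<in>UNIV. v i powi Poly_Mapping.lookup m i))"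
  unfolding leval_def using assms by (intro sum.mono_neutral_left) (auto simp: in_keys_iff)

lemma leval_single:
  "leval v (Poly_Mapping.single m c) = of_int c * (\<Prod>i\<in>UNIV. v i powi Poly_Mapping.lookup m i)"
  by (subst leval_superset[of "{m}"]) auto

lemma leval_add: "leval v (L + L') = leval v L + leval v L'"
proof -
  let ?S = "Poly_Mapping.keys L \<union> Poly_Mapping.keys L'"
  have "Poly_Mapping.keys (L + L') \<subseteq> ?S" by (rule Poly_Mapping.keys_add)
  then show ?thesis
    by (simp add: leval_superset[of ?S] lookup_add sum.distrib[symmetric] algebra_simps)
qed

lemma leval_0: "leval v 0 = 0"
  by (simp add: leval_def)

lemma leval_sum: "leval v (\<Sum>i\<in>I. f i) = (\<Sum>i\<in>I. leval v (f i))"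
  by (induction I rule: infinite_finite_induct) (simp_all add: leval_0 leval_add)

lemma sum_single_lookup:
  "(\<Sum>m\<in>Poly_Mapping.keys L. Poly_Mapping.single m (Poly_Mapping.lookup L m)) = L"
  by (rule poly_mapping_eqI)
    (auto simp: lookup_sum lookup_single when_def in_keys_iff)

text \<open>Multiplicativity on monomials is additivity of integer exponents. It fails at a zero
  coordinate, where \<open>0 powi 1 * 0 powi (-1)\<close> is 0 but \<open>0 powi 0\<close> is
  1.\<close>

lemma leval_mult:
  assumes "\<And>i. v i \<noteq> 0"
  shows "leval v (L * L') = leval v L * leval v L'"
proof -
  let ?e = "\<lambda>m. \<Prod>i\<in>UNIV. v i powi Poly_Mapping.lookup m i"
  have e: "?e (m + m') = ?e m * ?e m'" for m m'
    using assms by (simp add: lookup_add power_int_add prod.distrib)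
  have "L * L' = (\<Sum>m\<in>Poly_Mapping.keys L. Poly_Mapping.single m (Poly_Mapping.lookup L m)) *
      (\<Sum>m\<in>Poly_Mapping.keys L'. Poly_Mapping.single m (Poly_Mapping.lookup L' m))"
    by (simp only: sum_single_lookup)
  also have "leval v \<dots> = (\<Sum>m\<in>Poly_Mapping.keys L. \<Sum>m'\<in>Poly_Mapping.keys L'.
      of_int (Poly_Mapping.lookup L m) * ?e m * (of_int (Poly_Mapping.lookup L' m') * ?e m'))"
    by (simp add: sum_product leval_sum mult_single leval_single e mult_ac)
  also have "\<dots> = leval v L * leval v L'"
    by (simp add: leval_def sum_product)
  finally show ?thesis .
qed

lemma leval_lvar: "leval v (lvar i) = v i"
proof -
  have "v j powi Poly_Mapping.lookup (Poly_Mapping.single i 1) j = (if j = i then v j else 1)" for j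
    by (simp add: lookup_single when_def)
  then show ?thesis unfolding lvar_def leval_single by simp
qed

lemma leval_1: "leval v 1 = 1"
  using leval_single[of v 0 1] by simp

lemma lvar_unit: "\<exists>b. lvar i * b = 1"
  by (rule exI[of _ "Poly_Mapping.single (Poly_Mapping.single i (-1)) 1"])
    (simp add: lvar_def mult_single single_add[symmetric])

text \<open>Positivity at the point with all coordinates \<open>1\<close> keeps the terms of the generic sequence away
  from \<open>0\<close>.\<close>

definition pos_fract :: "laurent5 fract \<Rightarrow> bool" where
  "pos_fract x \<longleftrightarrow>
    (\<exists>a b. x = Fraction_Field.Fract a b \<and> leval (\<lambda>_. 1) a > 0 \<and> leval (\<lambda>_. 1) b > 0)"

lemma leval_nonzero: "leval v a \<noteq> 0 \<Longrightarrow> a \<noteq> 0"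
  using leval_0 by auto

lemma pos_fract_nonzero: "pos_fract x \<Longrightarrow> x \<noteq> 0"
  unfolding pos_fract_def Zero_fract_def using leval_nonzero[of "\<lambda>_. 1"]
  by (force simp: eq_fract leval_0)

lemma pos_fract_of: "leval (\<lambda>_. 1) a > 0 \<Longrightarrow> pos_fract (Fraction_Field.Fract a 1)"
  unfolding pos_fract_def using leval_1 by force

lemma pos_fract_add:
  assumes "pos_fract x" "pos_fract y"
  shows "pos_fract (x + y)"
proof -
  obtain a b c d where h: "x = Fraction_Field.Fract a b" "leval (\<lambda>_. 1) a > 0" "leval (\<lambda>_. 1) b > 0"
    "y = Fraction_Field.Fract c d" "leval (\<lambda>_. 1) c > 0" "leval (\<lambda>_. 1) d > 0"
    using assms unfolding pos_fract_def by blast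
  have "b \<noteq> 0" "d \<noteq> 0" using h leval_nonzero by (metis less_irrefl)+
  then have "x + y = Fraction_Field.Fract (a * d + c * b) (b * d)" using h by simp
  moreover have "leval (\<lambda>_. 1) (a * d + c * b) > 0" "leval (\<lambda>_. 1) (b * d) > 0"
    using h by (simp_all add: leval_add leval_mult add_pos_pos)
  ultimately show ?thesis unfolding pos_fract_def by blast
qed

lemma pos_fract_mult:
  assumes "pos_fract x" "pos_fract y"
  shows "pos_fract (x * y)"
proof -
  obtain a b c d where h: "x = Fraction_Field.Fract a b" "leval (\<lambda>_. 1) a > 0" "leval (\<lambda>_. 1) b > 0"
    "y = Fraction_Field.Fract c d" "leval (\<lambda>_. 1) c > 0" "leval (\<lambda>_. 1) d > 0"
    using assms unfolding pos_fract_def by blast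
  have "x * y = Fraction_Field.Fract (a * c) (b * d)" using h by simp
  moreover have "leval (\<lambda>_. 1) (a * c) > 0" "leval (\<lambda>_. 1) (b * d) > 0"
    using h by (simp_all add: leval_mult)
  ultimately show ?thesis unfolding pos_fract_def by blast
qed

lemma pos_fract_inverse: "pos_fract x \<Longrightarrow> pos_fract (inverse x)"
  unfolding pos_fract_def by (metis inverse_fract)

section \<open>Existence of the generic sequence\<close>

fun somos5_from :: "(nat \<Rightarrow> 'a::field) \<Rightarrow> nat \<Rightarrow> 'a" where
  "somos5_from u n = (if n < 5 then u n else
    (somos5_from u (n - 1) * somos5_from u (n - 4) + somos5_from u (n - 2) * somos5_from u (n - 3))
      / somos5_from u (n - 5))"

declare somos5_from.simps [simp del]

lemma is_subring_laurent: "is_subring (range (\<lambda>a::laurent5. Fraction_Field.Fract a 1))"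
  unfolding is_subring_def by (auto simp: One_fract_def)

text \<open>The recurrence is solved in the fraction field, where positivity excludes zero terms.
  Then \<open>somos5_mem_subring\<close> places every term in the image of the Laurent ring. The
  initial values are general units so that the lemma can be applied in both directions of the
  index.\<close>

lemma somos5_laurent_forward:
  fixes u :: "nat \<Rightarrow> laurent5"
  assumes unit: "\<And>i. i < 5 \<Longrightarrow> \<exists>b. u i * b = 1"
    and pos: "\<And>i. i < 5 \<Longrightarrow> leval (\<lambda>_. 1) (u i) > 0"
  shows "\<exists>F. (\<forall>n. F (n + 5) * F n = F (n + 4) * F (n + 1) + F (n + 3) * F (n + 2)) \<and>
    (\<forall>i<5. F i = u i)"
proof -
  let ?A = "range (\<lambda>a::laurent5. Fraction_Field.Fract a 1)"
  define x where "x = somos5_from (\<lambda>i. Fraction_Field.Fract (u i) 1)"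
  have init: "x i = Fraction_Field.Fract (u i) 1" if "i < 5" for i
    using that unfolding x_def by (simp add: somos5_from.simps)
  \<comment> \<open>This form holds even for a zero divisor, with the default value of
    \<open>inverse\<close>. The recurrence itself has to wait for \<open>nz\<close>.\<close>
  have step: "x (n + 5) = (x (n + 4) * x (n + 1) + x (n + 3) * x (n + 2)) * inverse (x n)" for n
  proof -
    have "n + 5 - 1 = n + 4" "n + 5 - 4 = n + 1" "n + 5 - 2 = n + 3" "n + 5 - 3 = n + 2"
      "n + 5 - 5 = n" "\<not> n + 5 < 5" by simp_all
    then show ?thesis unfolding x_def by (subst somos5_from.simps) (simp only: divide_inverse if_False)
  qed
  have pos_x: "pos_fract (x n)" for n
  proof (induction n rule: less_induct)
    case (less n)
    show ?case
    proof (cases "n < 5")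
      case True
      then show ?thesis using init pos pos_fract_of by simp
    next
      case False
      define k where "k = n - 5"
      have n: "n = k + 5" using False by (simp add: k_def)
      show ?thesis unfolding n step
        by (intro pos_fract_mult pos_fract_add pos_fract_inverse less.IH) (simp_all add: n)
    qed
  qed
  have nz: "x n \<noteq> 0" for n using pos_fract_nonzero[OF pos_x] .
  have rec: "x (n + 5) * x n = x (n + 4) * x (n + 1) + x (n + 3) * x (n + 2)" for n
    unfolding step using nz[of n] by simp
  have mem: "x i \<in> ?A" if "i < 5" for i using init[OF that] by simp
  have inv: "inverse (x i) \<in> ?A" if "i < 5" for i
  proof -
    obtain b where b: "u i * b = 1" using unit \<open>i < 5\<close> by blast
    then have "u i \<noteq> 0" by auto
    then have "inverse (x i) = Fraction_Field.Fract b 1"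
      using b by (simp add: init[OF that] eq_fract mult.commute)
    then show ?thesis by simp
  qed
  have "x n \<in> ?A" for n
  proof (rule somos5_mem_subring[OF rec nz is_subring_laurent])
    show "x i \<in> ?A" if "i \<le> 5" for i
    proof (cases "i = 5")
      case True
      \<comment> \<open>The sixth entry of the first window lies in the ring because its only
        denominator \<open>x 0\<close> is a unit.\<close>
      have "x (0 + 5) \<in> ?A" unfolding step
        by (intro is_subring_mult[OF is_subring_laurent] is_subring_add[OF is_subring_laurent] mem inv)
          simp_all
      then show ?thesis using True by simp
    qed (use mem that in simp)
  qed (use inv in simp)
  then have "\<forall>n. \<exists>a. x n = Fraction_Field.Fract a 1" by blast
  then obtain F where F: "\<And>n. x n = Fraction_Field.Fract (F n) 1" by metis
  have "F (n + 5) * F n = F (n + 4) * F (n + 1) + F (n + 3) * F (n + 2)" for n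
    using rec[of n] unfolding F by (simp add: eq_fract)
  moreover have "F i = u i" if "i < 5" for i
    using init[OF that] unfolding F by (simp add: eq_fract)
  ultimately show ?thesis by blast
qed

text \<open>The recurrence is symmetric under reversal. The negative half is thus a forward sequence
  \<open>G\<close> with reversed initial values, read at the index \<open>4 - n\<close>. It agrees
  with \<open>F\<close> on the overlap from 0 to 4.\<close>

lemma somos5_laurent_exists: "\<exists>T. is_somos5_laurent T"
proof -
  obtain F where F: "\<And>n. F (n + 5) * F n = F (n + 4) * F (n + 1) + F (n + 3) * F (n + 2)"
    "\<And>i. i < 5 \<Longrightarrow> F i = lvar (of_nat i)"
    using somos5_laurent_forward[of "\<lambda>i. lvar (of_nat i)"] lvar_unit by (auto simp: leval_lvar)
  obtain G where G: "\<And>n. G (n + 5) * G n = G (n + 4) * G (n + 1) + G (n + 3) * G (n + 2)"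
    "\<And>i. i < 5 \<Longrightarrow> G i = lvar (4 - of_nat i)"
    using somos5_laurent_forward[of "\<lambda>i. lvar (4 - of_nat i)"] lvar_unit by (auto simp: leval_lvar)
  define T where "T n = (if n \<ge> 0 then F (nat n) else G (nat (4 - n)))" for n
  have T0: "T n = F (nat n)" if "n \<ge> 0" for n using that by (simp add: T_def)
  have T1: "T n = G (nat (4 - n))" if "n \<le> 4" for n
  proof (cases "n \<ge> 0")
    case True
    then have "of_nat (nat n) = 4 - (of_nat (nat (4 - n)) :: 5)"
      using that by (simp add: of_nat_nat)
    then show ?thesis using True that by (simp add: T_def F(2) G(2))
  qed (simp add: T_def)
  have "T (n + 5) * T n = T (n + 4) * T (n + 1) + T (n + 3) * T (n + 2)" for n
  proof (cases "n \<ge> 0")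
    case True
    then show ?thesis using F(1)[of "nat n"] by (simp add: T0 nat_add_distrib)
  next
    case False
    \<comment> \<open>For negative \<open>n\<close> even \<open>n + 5\<close> is at most 4, so all
      six terms are values of \<open>G\<close>. The smallest index of \<open>G\<close> among them is
      \<open>4 - (n + 5) = k\<close>.\<close>
    define k where "k = nat (- n - 1)"
    have n: "n = - int k - 1" using False by (simp add: k_def)
    have e: "nat (4 - (n + 5)) = k" "nat (4 - (n + 4)) = k + 1" "nat (4 - (n + 3)) = k + 2"
      "nat (4 - (n + 2)) = k + 3" "nat (4 - (n + 1)) = k + 4" "nat (4 - n) = k + 5"
      unfolding n by simp_all
    show ?thesis using G(1)[of k] False by (simp add: T1 e[simplified] mult.commute)
  qed
  moreover have "has_initial_values T 0 lvar"
    unfolding has_initial_values_def by (simp add: T0 F(2))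
  ultimately show ?thesis unfolding is_somos5_laurent_def somos5_rec_def by blast
qed

section \<open>Uniqueness of the generic sequence\<close>

lemma int_five_step_induct:
  assumes init: "P (0::int)" "P 1" "P 2" "P 3" "P 4"
    and up: "\<And>n. P n \<Longrightarrow> P (n + 1) \<Longrightarrow> P (n + 2) \<Longrightarrow> P (n + 3) \<Longrightarrow> P (n + 4) \<Longrightarrow> P (n + 5)"
    and down: "\<And>n. P (n + 5) \<Longrightarrow> P (n + 1) \<Longrightarrow> P (n + 2) \<Longrightarrow> P (n + 3) \<Longrightarrow> P (n + 4) \<Longrightarrow> P n"
  shows "P n"
proof -
  have "P n \<and> P (n + 1) \<and> P (n + 2) \<and> P (n + 3) \<and> P (n + 4)" for n
  proof (induction n rule: int_induct[where k = 0])
    case base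
    then show ?case using init by simp
  next
    case (step1 i)
    then show ?case using up[of i] by (simp add: add.commute add.left_commute)
  next
    case (step2 i)
    then show ?case using down[of "i - 1"] by (simp add: algebra_simps)
  qed
  then show ?thesis by blast
qed

text \<open>At the point with all coordinates 1 the initial terms are 1, and the recurrence
  propagates positivity in both directions.\<close>

lemma is_somos5_laurent_nonzero:
  assumes "is_somos5_laurent T"
  shows "T n \<noteq> 0"
proof -
  let ?e = "leval (\<lambda>_. 1)"
  have "T (n + 5) * T n = T (n + 4) * T (n + 1) + T (n + 3) * T (n + 2)" for n
    using assms unfolding is_somos5_laurent_def somos5_rec_def by blast
  then have rec: "?e (T (n + 5)) * ?e (T n) =
      ?e (T (n + 4)) * ?e (T (n + 1)) + ?e (T (n + 3)) * ?e (T (n + 2))" for n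
    by (metis leval_add leval_mult one_neq_zero)
  have init: "T 0 = lvar 0" "T 1 = lvar 1" "T 2 = lvar 2" "T 3 = lvar 3" "T 4 = lvar 4"
    using assms unfolding is_somos5_laurent_def has_initial_values_def by simp_all
  have "?e (T n) > 0"
  proof (induction n rule: int_five_step_induct)
    case (6 n)
    then have "?e (T (n + 5)) * ?e (T n) > 0" unfolding rec by (simp add: add_pos_pos)
    then show ?case using 6(1) by (simp add: zero_less_mult_iff)
  next
    case (7 n)
    then have "?e (T (n + 5)) * ?e (T n) > 0" unfolding rec by (simp add: add_pos_pos)
    then show ?case using 7(1) by (simp add: zero_less_mult_iff)
  qed (simp_all add: init leval_lvar)
  then show ?thesis using leval_nonzero by (metis less_irrefl)
qed

lemma somos5_laurent_unique:
  assumes T: "is_somos5_laurent T" and T': "is_somos5_laurent T'"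
  shows "T = T'"
proof
  fix n
  note d = is_somos5_laurent_def somos5_rec_def has_initial_values_def
  have rec: "T (n + 5) * T n = T (n + 4) * T (n + 1) + T (n + 3) * T (n + 2)"
    "T' (n + 5) * T' n = T' (n + 4) * T' (n + 1) + T' (n + 3) * T' (n + 2)" for n
    using T T' unfolding d by blast+
  show "T n = T' n"
  proof (induction n rule: int_five_step_induct)
    case (6 n)
    then have "T (n + 5) * T n = T' (n + 5) * T n" using rec[of n] by simp
    then show ?case using is_somos5_laurent_nonzero[OF T] by simp
  next
    case (7 n)
    then have "T (n + 5) * T n = T (n + 5) * T' n" using rec[of n] by simp
    then show ?case using is_somos5_laurent_nonzero[OF T] by simp
  qed (use T T' in \<open>simp_all add: d\<close>)
qed

lemma somos5_laurent_ex1: "\<exists>!T. is_somos5_laurent T"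
  using somos5_laurent_exists somos5_laurent_unique by blast

lemma is_somos5_laurent_somos5_laurent: "is_somos5_laurent somos5_laurent"
  unfolding somos5_laurent_def by (rule theI'[OF somos5_laurent_ex1])

text \<open>For a rational sequence this does not follow from the recurrence where
  \<open>\<tau> (n+5)\<close> vanishes. It is therefore proved for the generic sequence, whose terms
  are nonzero, and transported by evaluation. In this way it controls the sequence beyond its
  zeros.\<close>

definition jump_rec :: "(int \<Rightarrow> 'a::comm_ring_1) \<Rightarrow> bool" where
  "jump_rec \<tau> \<longleftrightarrow> (\<forall>n.
    \<tau> (n+1) * \<tau> (n+1) * \<tau> (n+1) * \<tau> (n+2) * \<tau> (n+2) * \<tau> (n+3) * \<tau> (n+4) * \<tau> (n+10) =
    somos5_jump (\<tau> n) (\<tau> (n+1)) (\<tau> (n+2)) (\<tau> (n+3)) (\<tau> (n+4)) (\<tau> (n+5)))"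

lemma somos5_rec_imp_jump_rec:
  fixes \<tau> :: "int \<Rightarrow> 'a::idom"
  assumes rec: "somos5_rec \<tau>" and nz: "\<And>n. \<tau> n \<noteq> 0"
  shows "jump_rec \<tau>"
  unfolding jump_rec_def
proof
  fix n
  note r = rec[unfolded somos5_rec_def, rule_format]
  have r1: "\<tau> (n+6) * \<tau> (n+1) = \<tau> (n+5) * \<tau> (n+2) + \<tau> (n+4) * \<tau> (n+3)"
    using r[of "n+1"] by (simp add: add.assoc)
  have r2: "\<tau> (n+7) * \<tau> (n+2) = \<tau> (n+6) * \<tau> (n+3) + \<tau> (n+5) * \<tau> (n+4)"
    using r[of "n+2"] by (simp add: add.assoc)
  have r3: "\<tau> (n+8) * \<tau> (n+3) = \<tau> (n+7) * \<tau> (n+4) + \<tau> (n+6) * \<tau> (n+5)"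
    using r[of "n+3"] by (simp add: add.assoc)
  have r4: "\<tau> (n+9) * \<tau> (n+4) = \<tau> (n+8) * \<tau> (n+5) + \<tau> (n+7) * \<tau> (n+6)"
    using r[of "n+4"] by (simp add: add.assoc)
  have r5: "\<tau> (n+10) * \<tau> (n+5) = \<tau> (n+9) * \<tau> (n+6) + \<tau> (n+8) * \<tau> (n+7)"
    using r[of "n+5"] by (simp add: add.assoc)
  show "\<tau> (n+1) * \<tau> (n+1) * \<tau> (n+1) * \<tau> (n+2) * \<tau> (n+2) * \<tau> (n+3) * \<tau> (n+4) * \<tau> (n+10) =
    somos5_jump (\<tau> n) (\<tau> (n+1)) (\<tau> (n+2)) (\<tau> (n+3)) (\<tau> (n+4)) (\<tau> (n+5))"
    by (rule somos5_jump_eq[OF r r1 r2 r3 r4 r5 nz])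
qed

lemma somos5_rec_reverse: "somos5_rec \<tau> \<Longrightarrow> somos5_rec (\<lambda>n. \<tau> (- n))"
  unfolding somos5_rec_def
proof
  fix n assume "\<forall>n. \<tau> (n + 5) * \<tau> n = \<tau> (n + 4) * \<tau> (n + 1) + \<tau> (n + 3) * \<tau> (n + 2)"
  from this[rule_format, of "- n - 5"]
  show "\<tau> (- (n + 5)) * \<tau> (- n) = \<tau> (- (n + 4)) * \<tau> (- (n + 1)) + \<tau> (- (n + 3)) * \<tau> (- (n + 2))"
    by (simp add: algebra_simps)
qed

lemma somos5_rec_leval:
  assumes "\<And>i. v i \<noteq> 0" and "somos5_rec T"
  shows "somos5_rec (\<lambda>n. leval v (T n))"
  using assms(2) unfolding somos5_rec_def
  by (simp only: leval_add[symmetric] leval_mult[OF assms(1), symmetric] simp_thms)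

lemma jump_rec_leval:
  assumes "\<And>i. v i \<noteq> 0" and "jump_rec T"
  shows "jump_rec (\<lambda>n. leval v (T n))"
  unfolding jump_rec_def
proof
  fix n
  note h = leval_add leval_mult[OF assms(1)]
  show "leval v (T (n+1)) * leval v (T (n+1)) * leval v (T (n+1)) * leval v (T (n+2)) *
      leval v (T (n+2)) * leval v (T (n+3)) * leval v (T (n+4)) * leval v (T (n+10)) =
    somos5_jump (leval v (T n)) (leval v (T (n+1))) (leval v (T (n+2))) (leval v (T (n+3)))
      (leval v (T (n+4))) (leval v (T (n+5)))"
    using arg_cong[OF assms(2)[unfolded jump_rec_def, rule_format, of n], of "leval v"]
    by (simp only: h somos5_jump_def Let_def)
qed

text \<open>Each property is an identity of the generic sequence, evaluated at \<open>v\<close>. The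
  last one comes from the reversed generic sequence, which satisfies the same recurrence.\<close>

lemma somos5_properties:
  assumes v: "\<And>i. v i \<noteq> 0"
  shows "somos5_rec (somos5 s v)" and "has_initial_values (somos5 s v) s v"
    and "jump_rec (somos5 s v)" and "jump_rec (\<lambda>n. somos5 s v (- n))"
proof -
  let ?T = "\<lambda>n. somos5_laurent (n - s)"
  have S: "somos5 s v = (\<lambda>n. leval v (?T n))" by (auto simp: somos5_def)
  have "somos5_rec somos5_laurent"
    using is_somos5_laurent_somos5_laurent by (simp add: is_somos5_laurent_def)
  then have rec: "somos5_rec ?T" unfolding somos5_rec_def by (simp add: diff_add_eq[symmetric])
  show "somos5_rec (somos5 s v)" unfolding S by (rule somos5_rec_leval[OF v rec])
  have nz: "somos5_laurent n \<noteq> 0" for n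
    by (rule is_somos5_laurent_nonzero[OF is_somos5_laurent_somos5_laurent])
  show "jump_rec (somos5 s v)" unfolding S
    by (rule jump_rec_leval[OF v somos5_rec_imp_jump_rec[OF rec nz]])
  show "jump_rec (\<lambda>n. somos5 s v (- n))" unfolding S
    by (rule jump_rec_leval[OF v somos5_rec_imp_jump_rec[OF somos5_rec_reverse[OF rec] nz]])
  show "has_initial_values (somos5 s v) s v"
    using is_somos5_laurent_somos5_laurent
    by (simp add: S is_somos5_laurent_def has_initial_values_def leval_lvar)
qed

section \<open>Rational numbers integral at a prime\<close>

text \<open>For prime \<open>p\<close> this is the localization of the integers at the prime ideal
  (p). A zero denominator is excluded because \<open>p\<close> divides 0.\<close>

definition padic_int :: "nat \<Rightarrow> rat \<Rightarrow> bool" where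
  "padic_int p x \<longleftrightarrow> (\<exists>a b::int. x = of_int a / of_int b \<and> \<not> int p dvd b)"

definition padic_unit :: "nat \<Rightarrow> rat \<Rightarrow> bool" where
  "padic_unit p x \<longleftrightarrow> padic_int p x \<and> padic_int p (inverse x) \<and> x \<noteq> 0"

text \<open>Integrality of both sides is built in, so that a proof of congruence also proves
  integrality, and \<open>padic_cong p x x\<close> expresses integrality alone.\<close>

definition padic_cong :: "nat \<Rightarrow> rat \<Rightarrow> rat \<Rightarrow> bool" where
  "padic_cong p x y \<longleftrightarrow> padic_int p x \<and> padic_int p y \<and> padic_int p ((x - y) / of_nat p)"

context
  fixes p :: nat
  assumes p: "prime p"
begin

text \<open>Any fraction may replace the lowest terms c/d of \<open>quotient_of\<close>: the
  multiplicity of a prime is additive, and a*d = c*b.\<close>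

lemma padic_abs_of_int_divide:
  assumes "a \<noteq> 0" "b \<noteq> 0"
  shows "padic_abs p (of_int a / of_int b) =
    real p powi (int (multiplicity (int p) b) - int (multiplicity (int p) a))"
proof -
  obtain c d where q: "quotient_of (of_int a / of_int b) = (c, d)" by fastforce
  have d: "d > 0" using quotient_of_denom_pos[OF q] .
  have eq: "of_int a / of_int b = (of_int c / of_int d :: rat)" using quotient_of_div[OF q] .
  then have "of_int (a * d) = (of_int (c * b) :: rat)" using assms d by (simp add: field_simps)
  then have e: "a * d = c * b" by (simp only: of_int_eq_iff)
  then have c: "c \<noteq> 0" using assms d by auto
  have "prime_elem (int p)" using p by simp
  then have "multiplicity (int p) a + multiplicity (int p) d =
      multiplicity (int p) c + multiplicity (int p) b"
    using prime_elem_multiplicity_mult_distrib[of "int p"] assms c d e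
    by (metis less_irrefl)
  then have "int (multiplicity (int p) d) - int (multiplicity (int p) c) =
      int (multiplicity (int p) b) - int (multiplicity (int p) a)" by linarith
  then show ?thesis unfolding padic_abs_def using q assms by simp
qed

lemma padic_abs_mult: "padic_abs p (x * y) = padic_abs p x * padic_abs p y"
proof (cases "x = 0 \<or> y = 0")
  case True
  then show ?thesis by (auto simp: padic_abs_def)
next
  case False
  obtain a b where x: "x = of_int a / of_int b" "b \<noteq> 0"
    using quotient_of_div[of x] quotient_of_denom_pos[of x] by (metis less_irrefl surj_pair)
  obtain c d where y: "y = of_int c / of_int d" "d \<noteq> 0"
    using quotient_of_div[of y] quotient_of_denom_pos[of y] by (metis less_irrefl surj_pair)
  have nz: "a \<noteq> 0" "c \<noteq> 0" using x y False by auto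
  have pe: "prime_elem (int p)" "real p \<noteq> 0" using p by auto
  have "x * y = of_int (a * c) / of_int (b * d)" by (simp add: x y)
  then have "padic_abs p (x * y) = real p powi
      (int (multiplicity (int p) (b * d)) - int (multiplicity (int p) (a * c)))"
    using padic_abs_of_int_divide[of "a * c" "b * d"] nz x y by simp
  also have "\<dots> = padic_abs p x * padic_abs p y"
    using nz x(2) y(2) pe unfolding x(1) y(1)
    by (simp add: padic_abs_of_int_divide prime_elem_multiplicity_mult_distrib
      power_int_add[symmetric] algebra_simps)
  finally show ?thesis .
qed

lemma padic_int_quotient_of:
  assumes "padic_int p x"
  shows "\<not> int p dvd snd (quotient_of x)"
proof
  assume dvd: "int p dvd snd (quotient_of x)"
  obtain c d where q: "quotient_of x = (c, d)" by fastforce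
  obtain a b where ab: "x = of_int a / of_int b" "\<not> int p dvd b"
    using assms unfolding padic_int_def by blast
  have "b \<noteq> 0" "d \<noteq> 0" using ab quotient_of_denom_pos[OF q] by auto
  then have "of_int (a * d) = (of_int (c * b) :: rat)"
    using quotient_of_div[OF q] ab by (simp add: field_simps)
  then have "a * d = c * b" by (simp only: of_int_eq_iff)
  then have "int p dvd c * b" using dvd q by (metis dvd_mult snd_conv)
  then have "int p dvd c" using ab(2) p by (simp add: prime_dvd_mult_iff)
  then show False using quotient_of_coprime[OF q] dvd q p
    by (metis coprime_common_divisor not_prime_unit prime_nat_int_transfer snd_conv)
qed

text \<open>In lowest terms \<open>p\<close> divides at most one of numerator and denominator, so
  the sign of the exponent is decided by whether \<open>p\<close> divides the denominator.\<close>

lemma padic_abs_le_1_iff: "padic_abs p x \<le> 1 \<longleftrightarrow> padic_int p x"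
proof -
  obtain a b where q: "quotient_of x = (a, b)" by fastforce
  have x: "x = of_int a / of_int b" and b: "b > 0" and cop: "coprime a b"
    using quotient_of_div[OF q] quotient_of_denom_pos[OF q] quotient_of_coprime[OF q] by auto
  have p1: "real p > 1" using prime_gt_1_nat[OF p] by simp
  have pe: "\<not> is_unit (int p)" using p by (metis not_prime_unit prime_nat_int_transfer)
  show ?thesis
  proof (cases "int p dvd b")
    case True
    then have "\<not> int p dvd a" using cop pe by (metis coprime_common_divisor)
    then have m: "multiplicity (int p) a = 0" and a: "a \<noteq> 0"
      by (auto simp: not_dvd_imp_multiplicity_0)
    have "multiplicity (int p) b > 0" using True b pe multiplicity_gt_zero_iff[of b "int p"] by simp
    then have "padic_abs p x > 1" unfolding x using a b m p1
      by (simp add: padic_abs_of_int_divide power_int_def)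
    moreover have "\<not> padic_int p x" using padic_int_quotient_of[of x] True q by auto
    ultimately show ?thesis by simp
  next
    case False
    then have "padic_int p x" unfolding padic_int_def using x by blast
    moreover have "padic_abs p x \<le> 1"
    proof (cases "a = 0")
      case True
      then show ?thesis by (simp add: x padic_abs_def)
    next
      case a: False
      have "multiplicity (int p) b = 0" using False by (rule not_dvd_imp_multiplicity_0)
      then have "padic_abs p x = inverse (real p ^ multiplicity (int p) a)"
        unfolding x using a b by (simp add: padic_abs_of_int_divide power_int_minus)
      also have "\<dots> \<le> 1" using p1 by (intro inverse_le_1_iff[THEN iffD2]) (simp add: one_le_power)
      finally show ?thesis .
    qed
    ultimately show ?thesis by simp
  qed
qed

lemma padic_abs_pos: "x \<noteq> 0 \<Longrightarrow> padic_abs p x > 0"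
  unfolding padic_abs_def using prime_gt_0_nat[OF p] by (simp add: zero_less_power_int)

lemma padic_abs_le_imp_padic_int:
  assumes "padic_abs p x \<le> padic_abs p y" "y \<noteq> 0"
  shows "padic_int p (x / y)"
proof -
  have "padic_abs p (x / y) * padic_abs p y = padic_abs p x"
    using assms(2) by (simp add: padic_abs_mult[symmetric])
  then have "padic_abs p (x / y) \<le> 1"
    using assms(1) padic_abs_pos[OF assms(2)]
    by (metis mult_le_cancel_right1 mult_le_cancel_right2 not_less)
  then show ?thesis using padic_abs_le_1_iff by simp
qed

lemma padic_abs_eq_1_imp_padic_unit:
  assumes "padic_abs p x = 1"
  shows "padic_unit p x"
proof -
  have "x \<noteq> 0" using assms by (auto simp: padic_abs_def)
  moreover have "padic_abs p 1 = 1" using padic_abs_of_int_divide[of 1 1] by simp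
  ultimately show ?thesis
    unfolding padic_unit_def
    using padic_abs_le_imp_padic_int[of 1 x] padic_abs_le_1_iff[of x] assms
    by (simp add: inverse_eq_divide)
qed

section \<open>Arithmetic in the local ring at p and its residue field\<close>

lemma padic_int_of_int: "padic_int p (of_int a)"
  unfolding padic_int_def using p not_prime_1
  by (intro exI[of _ a] exI[of _ 1]) (auto simp: zdvd1_eq)

lemma padic_int_add:
  assumes "padic_int p x" "padic_int p y"
  shows "padic_int p (x + y)"
proof -
  obtain a b c d where h: "x = of_int a / of_int b" "\<not> int p dvd b"
    "y = of_int c / of_int d" "\<not> int p dvd d"
    using assms unfolding padic_int_def by blast
  then have "b \<noteq> 0" "d \<noteq> 0" by auto
  then have "x + y = of_int (a * d + c * b) / of_int (b * d)" using h by (simp add: field_simps)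
  moreover have "\<not> int p dvd b * d" using h p by (simp add: prime_dvd_mult_iff)
  ultimately show ?thesis unfolding padic_int_def by blast
qed

lemma padic_int_mult:
  assumes "padic_int p x" "padic_int p y"
  shows "padic_int p (x * y)"
proof -
  obtain a b c d where h: "x = of_int a / of_int b" "\<not> int p dvd b"
    "y = of_int c / of_int d" "\<not> int p dvd d"
    using assms unfolding padic_int_def by blast
  then have "x * y = of_int (a * c) / of_int (b * d)" by simp
  moreover have "\<not> int p dvd b * d" using h p by (simp add: prime_dvd_mult_iff)
  ultimately show ?thesis unfolding padic_int_def by blast
qed

lemma not_padic_int_inverse: "\<not> padic_int p (inverse (of_nat p))"
proof
  assume "padic_int p (inverse (of_nat p))"
  then obtain a b where ab: "inverse (of_nat p) = (of_int a / of_int b :: rat)" "\<not> int p dvd b"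
    unfolding padic_int_def by blast
  then have "b \<noteq> 0" "p \<noteq> 0" using p by auto
  then have "of_int b = (of_int (int p * a) :: rat)" using ab by (simp add: field_simps)
  then have "b = int p * a" by (simp only: of_int_eq_iff)
  then show False using ab(2) by simp
qed

text \<open>The ring is local with maximal ideal generated by \<open>p\<close>: if \<open>p\<close>
  did not divide the numerator, the inverse would be integral too.\<close>

lemma padic_nonunit:
  assumes "padic_int p x" "\<not> padic_unit p x"
  shows "padic_int p (x / of_nat p)"
proof -
  obtain a b where ab: "x = of_int a / of_int b" "\<not> int p dvd b"
    using assms unfolding padic_int_def by blast
  have "int p dvd a"
  proof (rule ccontr)
    assume "\<not> int p dvd a"
    moreover have "inverse x = of_int b / of_int a" using ab by simp
    ultimately have "padic_int p (inverse x)" "x \<noteq> 0"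
      using ab unfolding padic_int_def by auto
    then show False using assms unfolding padic_unit_def by blast
  qed
  then obtain c where "a = int p * c" by blast
  then have "x / of_nat p = of_int c / of_int b" using ab p by simp
  then show ?thesis using ab(2) unfolding padic_int_def by blast
qed

lemma padic_unit_mult: "padic_unit p x \<Longrightarrow> padic_unit p y \<Longrightarrow> padic_unit p (x * y)"
  unfolding padic_unit_def by (simp add: padic_int_mult)

lemma padic_unit_inverse: "padic_unit p x \<Longrightarrow> padic_unit p (inverse x)"
  unfolding padic_unit_def by simp

lemma padic_cong_refl: "padic_cong p x x \<longleftrightarrow> padic_int p x"
  unfolding padic_cong_def using padic_int_of_int[of 0] by simp

lemma padic_cong_sym: "padic_cong p x y \<Longrightarrow> padic_cong p y x"
  unfolding padic_cong_def using padic_int_mult[of "-1" "(x - y) / of_nat p"] padic_int_of_int[of "-1"]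
  by (simp add: minus_divide_left)

lemma padic_cong_add:
  assumes "padic_cong p x y" "padic_cong p x' y'"
  shows "padic_cong p (x + x') (y + y')"
proof -
  have "(x + x' - (y + y')) / of_nat p = (x - y) / of_nat p + (x' - y') / of_nat p"
    by (simp add: add_divide_distrib[symmetric])
  then show ?thesis using assms padic_int_add unfolding padic_cong_def by metis
qed

lemma padic_cong_mult:
  assumes "padic_cong p x y" "padic_cong p x' y'"
  shows "padic_cong p (x * x') (y * y')"
proof -
  have "(x * x' - y * y') / of_nat p = x * ((x' - y') / of_nat p) + y' * ((x - y) / of_nat p)"
    by (simp add: diff_divide_distrib algebra_simps)
  then show ?thesis using assms padic_int_add padic_int_mult unfolding padic_cong_def by metis
qed

lemma padic_cong_trans: "padic_cong p x y \<Longrightarrow> padic_cong p y z \<Longrightarrow> padic_cong p x z"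
  using padic_int_add[of "(x - y) / of_nat p" "(y - z) / of_nat p"]
  unfolding padic_cong_def by (simp add: add_divide_distrib[symmetric])

text \<open>If \<open>y\<close> were a nonunit, \<open>p\<close> would divide \<open>y\<close> and
  hence the unit \<open>x\<close>, making 1/p integral.\<close>

lemma padic_unit_cong:
  assumes "padic_cong p x y" "padic_unit p x"
  shows "padic_unit p y"
proof (rule ccontr)
  assume "\<not> padic_unit p y"
  then have "padic_int p (y / of_nat p)" using assms(1) padic_nonunit unfolding padic_cong_def by blast
  then have "padic_int p ((x - y) / of_nat p + y / of_nat p)"
    using assms(1) padic_int_add unfolding padic_cong_def by blast
  then have "padic_int p (x / of_nat p)" by (simp add: add_divide_distrib[symmetric])
  then have "padic_int p (inverse x * (x / of_nat p))"
    using assms(2) padic_int_mult unfolding padic_unit_def by blast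
  then show False using not_padic_int_inverse assms(2) unfolding padic_unit_def
    by (simp add: inverse_eq_divide)
qed

lemma padic_cong_inverse:
  assumes c: "padic_cong p x y" and u: "padic_unit p x"
  shows "padic_cong p (inverse x) (inverse y)"
proof -
  have v: "padic_unit p y" using padic_unit_cong[OF c u] .
  have "(inverse x - inverse y) / of_nat p = inverse x * inverse y * ((y - x) / of_nat p)"
    using u v p unfolding padic_unit_def by (simp add: field_simps)
  moreover have "padic_int p (inverse x * inverse y * ((y - x) / of_nat p))"
    using u v padic_cong_sym[OF c] unfolding padic_unit_def padic_cong_def
    by (intro padic_int_mult) auto
  ultimately show ?thesis using u v unfolding padic_unit_def padic_cong_def by metis
qed

text \<open>Integrality of \<open>x\<close> and \<open>y\<close> is a conclusion here, not a
  hypothesis. This is how new terms of the sequence become integral.\<close>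

lemma padic_cong_cancel:
  assumes "padic_cong p (u * x) (w * y)" "padic_cong p u w" "padic_unit p u"
  shows "padic_cong p x y"
proof -
  have "padic_unit p w" using padic_unit_cong assms(2,3) .
  then have "inverse u * (u * x) = x" "inverse w * (w * y) = y"
    using assms(3) unfolding padic_unit_def by (simp_all add: mult.assoc[symmetric])
  then show ?thesis using padic_cong_mult[OF padic_cong_inverse[OF assms(2,3)] assms(1)] by metis
qed

text \<open>If x = a/b and r is the reduced value, then r*b is congruent to a modulo
  \<open>p\<close>, so the numerator of x - r = (a - r*b)/b is divisible by
  \<open>p\<close>.\<close>

lemma padic_cong_padic_reduce:
  assumes "padic_int p x"
  shows "padic_cong p x (of_int (padic_reduce p x))"
proof -
  obtain a b where q: "quotient_of x = (a, b)" by fastforce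
  have nd: "\<not> int p dvd b" using padic_int_quotient_of[OF assms] q by simp
  have x: "x = of_int a / of_int b" "b > 0" using quotient_of_div[OF q] quotient_of_denom_pos[OF q] by auto
  define i where "i = modular_inverse (int p) b"
  have "coprime b (int p)" using nd p prime_imp_coprime[of "int p" b] by (simp add: coprime_commute)
  then have "[b * i = 1] (mod int p)" unfolding i_def by (rule cong_modular_inverse1)
  then have "[a * (b * i) = a * 1] (mod int p)" by (rule cong_scalar_left)
  moreover have "[padic_reduce p x = a * i] (mod int p)"
    unfolding padic_reduce_def q i_def by (simp add: cong_def)
  then have "[padic_reduce p x * b = a * i * b] (mod int p)" by (rule cong_scalar_right)
  ultimately have "[padic_reduce p x * b = a] (mod int p)"
    by (simp add: cong_def mult_ac)
  then have "int p dvd a - padic_reduce p x * b" by (simp add: cong_iff_dvd_diff dvd_diff_commute)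
  then obtain k where k: "a - padic_reduce p x * b = int p * k" by blast
  have "x - of_int (padic_reduce p x) = of_int (a - padic_reduce p x * b) / of_int b"
    using x by (simp add: field_simps)
  then have "(x - of_int (padic_reduce p x)) / of_nat p =
      of_int (a - padic_reduce p x * b) / of_int b / of_nat p" by (simp only:)
  also have "\<dots> = of_int k / of_int b" unfolding k using x p by simp
  finally have "padic_int p ((x - of_int (padic_reduce p x)) / of_nat p)"
    unfolding padic_int_def using nd by blast
  then show ?thesis using assms padic_int_of_int unfolding padic_cong_def by blast
qed

lemma padic_reduce_range: "padic_reduce p x \<in> {0..<int p}"
  unfolding padic_reduce_def using prime_gt_0_nat[OF p] by simp

lemma padic_reduce_eq_iff:
  assumes "padic_int p x" "padic_int p y"
  shows "padic_reduce p x = padic_reduce p y \<longleftrightarrow> padic_cong p x y"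
proof
  assume "padic_reduce p x = padic_reduce p y"
  then show "padic_cong p x y"
    using padic_cong_trans padic_cong_sym padic_cong_padic_reduce assms by metis
next
  assume "padic_cong p x y"
  then have "padic_cong p (of_int (padic_reduce p x)) (of_int (padic_reduce p y))"
    using padic_cong_trans padic_cong_sym padic_cong_padic_reduce assms by metis
  then obtain a b where ab: "of_int (padic_reduce p x - padic_reduce p y) / of_nat p =
      (of_int a / of_int b :: rat)" "\<not> int p dvd b"
    unfolding padic_cong_def padic_int_def by auto
  then have "b \<noteq> 0" "p \<noteq> 0" using p by auto
  then have "of_int ((padic_reduce p x - padic_reduce p y) * b) = (of_int (int p * a) :: rat)"
    using ab(1) by (simp add: field_simps)
  then have "(padic_reduce p x - padic_reduce p y) * b = int p * a" by (simp only: of_int_eq_iff)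
  then have "int p dvd (padic_reduce p x - padic_reduce p y) * b" by simp
  then have "int p dvd padic_reduce p x - padic_reduce p y"
    using ab(2) p by (simp add: prime_dvd_mult_iff)
  moreover have "\<bar>padic_reduce p x - padic_reduce p y\<bar> < int p"
    using padic_reduce_range[of x] padic_reduce_range[of y] by auto
  ultimately show "padic_reduce p x = padic_reduce p y"
    by (metis dvd_imp_le_int eq_iff_diff_eq_0 not_le abs_of_nat)
qed


section \<open>Propagation of congruent windows\<close>

text \<open>Units are required at \<open>n\<close> only, since congruence carries them over to
  \<open>m\<close>. The case \<open>m = n\<close> says that the window at \<open>n\<close> is
  integral with unit inner terms, so one relation treats both integrality and the dependence on
  residues.\<close>

definition window_cong :: "(int \<Rightarrow> rat) \<Rightarrow> int \<Rightarrow> int \<Rightarrow> bool" where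
  "window_cong \<tau> n m \<longleftrightarrow>
    padic_cong p (\<tau> n) (\<tau> m) \<and> padic_cong p (\<tau> (n+1)) (\<tau> (m+1)) \<and>
    padic_cong p (\<tau> (n+2)) (\<tau> (m+2)) \<and> padic_cong p (\<tau> (n+3)) (\<tau> (m+3)) \<and>
    padic_cong p (\<tau> (n+4)) (\<tau> (m+4)) \<and> padic_cong p (\<tau> (n+5)) (\<tau> (m+5)) \<and>
    padic_unit p (\<tau> (n+1)) \<and> padic_unit p (\<tau> (n+2)) \<and>
    padic_unit p (\<tau> (n+3)) \<and> padic_unit p (\<tau> (n+4))"

lemma window_cong_step:
  assumes rec: "somos5_rec \<tau>" and jump: "jump_rec \<tau>" and W: "window_cong \<tau> n m"
  shows "window_cong \<tau> (n+1) (m+1) \<or> window_cong \<tau> (n+5) (m+5)"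
proof -
  note r = rec[unfolded somos5_rec_def, rule_format]
  note j = jump[unfolded jump_rec_def, rule_format]
  have c: "padic_cong p (\<tau> n) (\<tau> m)" "padic_cong p (\<tau> (n+1)) (\<tau> (m+1))"
    "padic_cong p (\<tau> (n+2)) (\<tau> (m+2))" "padic_cong p (\<tau> (n+3)) (\<tau> (m+3))"
    "padic_cong p (\<tau> (n+4)) (\<tau> (m+4))" "padic_cong p (\<tau> (n+5)) (\<tau> (m+5))"
    and u: "padic_unit p (\<tau> (n+1))" "padic_unit p (\<tau> (n+2))"
    "padic_unit p (\<tau> (n+3))" "padic_unit p (\<tau> (n+4))"
    using W unfolding window_cong_def by blast+
  note ca = padic_cong_add and cm = padic_cong_mult
  have r1: "\<tau> (k+1) * \<tau> (k+6) = \<tau> (k+4) * \<tau> (k+3) + \<tau> (k+5) * \<tau> (k+2)" for k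
    using r[of "k+1"] by (simp add: add.assoc mult.commute add.commute)
  \<comment> \<open>The right sides of the recurrence are congruent at \<open>n\<close> and
    \<open>m\<close>, and the unit \<open>\<tau> (n+1)\<close> cancels. The same pattern gives
    \<open>c7\<close> to \<open>c9\<close>.\<close>
  have c6: "padic_cong p (\<tau> (n+6)) (\<tau> (m+6))"
    by (rule padic_cong_cancel[OF _ c(2) u(1)], unfold r1) (intro ca cm c)
  show ?thesis
  proof (cases "padic_unit p (\<tau> (n+5))")
    case True
    then have "window_cong \<tau> (n+1) (m+1)"
      using c u c6 unfolding window_cong_def by (simp add: add.assoc)
    then show ?thesis by blast
  next
    case False
    have z: "padic_int p (\<tau> (n+5) / of_nat p)"
      using padic_nonunit[OF _ False] c(6) unfolding padic_cong_def by blast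
    \<comment> \<open>As \<open>p\<close> divides \<open>\<tau> (n+5)\<close>, the product
      \<open>a * x\<close> is congruent to the unit \<open>b\<close>. The relations
      \<open>r1\<close> to \<open>r4\<close> are arranged in this shape.\<close>
    have unit_step: "padic_unit p x"
      if "a * x = b + \<tau> (n+5) * w" "padic_unit p a" "padic_unit p b" "padic_int p w" for a b w x
    proof -
      have "padic_int p (\<tau> (n+5) / of_nat p * w)" using padic_int_mult z that(4) .
      then have "padic_cong p b (a * x)"
        unfolding that(1) padic_cong_def
        using that(3,4) c(6) padic_int_add padic_int_mult padic_int_mult[of "-1"] padic_int_of_int[of "-1"]
        by (auto simp: padic_unit_def padic_cong_def)
      then have "padic_unit p (a * x)" using padic_unit_cong that(3) by blast
      then have "padic_unit p (inverse a * (a * x))"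
        using padic_unit_mult padic_unit_inverse that(2) by blast
      moreover have "inverse a * (a * x) = x"
        using that(2) unfolding padic_unit_def by (simp add: mult.assoc[symmetric])
      ultimately show ?thesis by metis
    qed
    have i: "padic_int p x" if "padic_unit p x" for x using that unfolding padic_unit_def by blast
    have r2: "\<tau> (k+2) * \<tau> (k+7) = \<tau> (k+6) * \<tau> (k+3) + \<tau> (k+5) * \<tau> (k+4)" for k
      using r[of "k+2"] by (simp add: add.assoc mult.commute)
    have r3: "\<tau> (k+3) * \<tau> (k+8) = \<tau> (k+7) * \<tau> (k+4) + \<tau> (k+5) * \<tau> (k+6)" for k
      using r[of "k+3"] by (simp add: add.assoc mult.commute)
    have r4: "\<tau> (k+4) * \<tau> (k+9) = \<tau> (k+7) * \<tau> (k+6) + \<tau> (k+5) * \<tau> (k+8)" for k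
      using r[of "k+4"] by (simp add: add.assoc mult.commute add.commute)
    have u6: "padic_unit p (\<tau> (n+6))"
      by (rule unit_step[OF r1]) (intro padic_unit_mult u i)+
    have u7: "padic_unit p (\<tau> (n+7))"
      by (rule unit_step[OF r2]) (intro padic_unit_mult u u6 i)+
    have u8: "padic_unit p (\<tau> (n+8))"
      by (rule unit_step[OF r3]) (intro padic_unit_mult u u6 u7 i)+
    have u9: "padic_unit p (\<tau> (n+9))"
      by (rule unit_step[OF r4]) (intro padic_unit_mult u u6 u7 u8 i)+
    have c7: "padic_cong p (\<tau> (n+7)) (\<tau> (m+7))"
      by (rule padic_cong_cancel[OF _ c(3) u(2)], unfold r2) (intro ca cm c c6)
    have c8: "padic_cong p (\<tau> (n+8)) (\<tau> (m+8))"
      by (rule padic_cong_cancel[OF _ c(4) u(3)], unfold r3) (intro ca cm c c6 c7)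
    have c9: "padic_cong p (\<tau> (n+9)) (\<tau> (m+9))"
      by (rule padic_cong_cancel[OF _ c(5) u(4)], unfold r4) (intro ca cm c c6 c7 c8)
    \<comment> \<open>The recurrence would require cancelling the nonunit
      \<open>\<tau> (n+5)\<close>. The jump identity has a product of units in front of
      \<open>\<tau> (n+10)\<close> instead.\<close>
    have c10: "padic_cong p (\<tau> (n+10)) (\<tau> (m+10))"
      by (rule padic_cong_cancel[of
          "\<tau> (n+1) * \<tau> (n+1) * \<tau> (n+1) * \<tau> (n+2) * \<tau> (n+2) * \<tau> (n+3) * \<tau> (n+4)" _
          "\<tau> (m+1) * \<tau> (m+1) * \<tau> (m+1) * \<tau> (m+2) * \<tau> (m+2) * \<tau> (m+3) * \<tau> (m+4)"],
          unfold j somos5_jump_def Let_def)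
        (intro ca cm c padic_unit_mult u)+
    have "window_cong \<tau> (n+5) (m+5)"
      using c u6 u7 u8 u9 c6 c7 c8 c9 c10 unfolding window_cong_def by (simp add: add.assoc)
    then show ?thesis by blast
  qed
qed

text \<open>A window covers the offsets 0 to 5 and moves by at most 5, so successive windows leave
  no gap.\<close>

lemma window_cong_forward:
  assumes rec: "somos5_rec \<tau>" and jump: "jump_rec \<tau>" and W: "window_cong \<tau> n m"
  shows "padic_cong p (\<tau> (n + int k)) (\<tau> (m + int k))"
  using W
proof (induction k arbitrary: n m rule: less_induct)
  case (less k)
  show ?case
  proof (cases "k \<le> 5")
    case True
    then have "k \<in> {0,1,2,3,4,5}" by auto
    then show ?thesis using less.prems unfolding window_cong_def by auto
  next
    case False
    have *: ?thesis if "window_cong \<tau> (n + int d) (m + int d)" "0 < d" "d \<le> 5" for d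
      using less.IH[OF _ that(1), of "k - d"] that False by (simp add: of_nat_diff)
    show ?thesis using window_cong_step[OF rec jump less.prems] *[of 1] *[of 5] by auto
  qed
qed

lemma window_cong_reverse: "window_cong \<tau> n m \<Longrightarrow> window_cong (\<lambda>i. \<tau> (- i)) (- n - 5) (- m - 5)"
  unfolding window_cong_def by (simp add: add.commute)

lemma window_cong_all:
  assumes rec: "somos5_rec \<tau>" and jump: "jump_rec \<tau>" "jump_rec (\<lambda>n. \<tau> (- n))"
    and W: "window_cong \<tau> n m"
  shows "padic_cong p (\<tau> (n + k)) (\<tau> (m + k))"
proof (cases "k \<ge> 0")
  case True
  then show ?thesis using window_cong_forward[OF rec jump(1) W, of "nat k"] by simp
next
  case False
  \<comment> \<open>The reversed window starts at \<open>- n - 5\<close>, and \<open>5 - k\<close>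
    steps from there lead to the index \<open>- (n + k)\<close>.\<close>
  then show ?thesis
    using window_cong_forward[OF somos5_rec_reverse[OF rec] jump(2) window_cong_reverse[OF W], of "nat (5 - k)"]
    by (simp add: algebra_simps)
qed

lemma window_cong_unbounded:
  assumes rec: "somos5_rec \<tau>" and jump: "jump_rec \<tau>" and W: "window_cong \<tau> n n"
  shows "\<exists>m\<ge>n + int k. window_cong \<tau> m m"
proof (induction k)
  case 0
  then show ?case using W by auto
next
  case (Suc k)
  then obtain m where "m \<ge> n + int k" "window_cong \<tau> m m" by blast
  then show ?case using window_cong_step[OF rec jump, of m m]
    by (metis add.assoc add_mono int_ops(4) one_le_numeral order_refl)
qed

text \<open>Infinitely many positions carry a window, but there are finitely many vectors of six
  residues, so two positions \<open>a < b\<close> share one. Propagation in both directions then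
  makes \<open>b - a\<close> a period of the whole sequence, without a preperiod.\<close>

lemma window_cong_periodic:
  assumes rec: "somos5_rec \<tau>" and jump: "jump_rec \<tau>" "jump_rec (\<lambda>n. \<tau> (- n))"
    and W: "window_cong \<tau> n0 n0"
  shows "(\<forall>n. padic_int p (\<tau> n)) \<and> (\<exists>N>0. \<forall>n. padic_reduce p (\<tau> (n + N)) = padic_reduce p (\<tau> n))"
proof -
  have int: "padic_int p (\<tau> n)" for n
    using window_cong_all[OF rec jump W, of "n - n0"] by (simp add: padic_cong_refl)
  define G where "G = {n. window_cong \<tau> n n}"
  define g where "g n = map (\<lambda>i. padic_reduce p (\<tau> (n + i))) [0,1,2,3,4,5]" for n
  have "infinite G"
  proof
    assume "finite G"
    then obtain B where B: "\<And>n. n \<in> G \<Longrightarrow> n \<le> B"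
      by (meson bdd_above.E bdd_above_finite)
    obtain m where "m \<ge> n0 + int (nat (B - n0 + 1))" "m \<in> G"
      using window_cong_unbounded[OF rec jump(1) W] unfolding G_def by blast
    then show False using B[of m] by linarith
  qed
  moreover have "g ` G \<subseteq> {xs. set xs \<subseteq> {0..<int p} \<and> length xs = 6}"
    using padic_reduce_range unfolding g_def by auto
  then have "finite (g ` G)" by (rule finite_subset) (simp add: finite_lists_length_eq)
  ultimately have "\<not> inj_on g G" using finite_imageD by blast
  then obtain a b where ab: "a \<in> G" "b \<in> G" "a < b" "g a = g b"
    unfolding inj_on_def by (metis linorder_neqE)
  have "window_cong \<tau> a b"
    using ab(1,4) int unfolding G_def window_cong_def g_def
    by (simp add: padic_reduce_eq_iff)
  then have c: "padic_cong p (\<tau> (a + k)) (\<tau> (b + k))" for k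
    using window_cong_all[OF rec jump] by blast
  have "padic_reduce p (\<tau> (n + (b - a))) = padic_reduce p (\<tau> n)" for n
    using c[of "n - a"] padic_reduce_eq_iff[OF int int, of n "n + (b - a)"] by (simp add: algebra_simps)
  then show ?thesis using ab(3) int by (intro conjI allI exI[of _ "b - a"]) auto
qed

end

section \<open>From well-balanced initial values to a first window\<close>

theorem theorem2p6:
  fixes p :: nat and s :: int and v :: "5 \<Rightarrow> rat"
  assumes "prime p"
    and "well_balanced p s v"
  shows "(\<exists>!T. is_somos5_laurent T) \<and>
         somos5_rec (somos5 s v) \<and> has_initial_values (somos5 s v) s v \<and>
         (\<forall>n. padic_abs p (somos5 s v n) \<le> 1) \<and>
         (\<exists>N::int. N > 0 \<and>
            (\<forall>n. padic_reduce p (somos5 s v (n + N)) = padic_reduce p (somos5 s v n)))"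
proof -
  note p = assms(1)
  have UNIV5: "i = 0 \<or> i = 1 \<or> i = 2 \<or> i = 3 \<or> i = 4" for i :: 5
  proof (cases i)
    case (of_int z)
    then have "z \<in> {0,1,2,3,4}" by auto
    then show ?thesis using of_int by auto
  qed
  \<comment> \<open>Four values have absolute value 1, and the distinguished one is nonzero by
    assumption.\<close>
  have v: "v i \<noteq> 0" for i
    using assms(2) UNIV5[of i] unfolding well_balanced_def balanced_values_def
    by (auto simp: padic_abs_def)
  define \<tau> where "\<tau> = somos5 s v"
  note props = somos5_properties[where v = v and s = s, OF v, folded \<tau>_def]
  note u = padic_abs_eq_1_imp_padic_unit[OF p]
  have r: "\<tau> 5 * \<tau> 0 = \<tau> 4 * \<tau> 1 + \<tau> 3 * \<tau> 2"
    using props(1)[unfolded somos5_rec_def, rule_format, of 0] by simp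
  \<comment> \<open>Both kinds of initial data lead to the same window from 0 to 5. The lower bound
    on the distinguished outer term says precisely that the opposite outer term, the quotient of
    \<open>\<tau> 4 * \<tau> 1 + \<tau> 3 * \<tau> 2\<close> by it, is integral.\<close>
  have "padic_int p (\<tau> 0) \<and> padic_int p (\<tau> 5) \<and> padic_unit p (\<tau> 1) \<and> padic_unit p (\<tau> 2) \<and>
      padic_unit p (\<tau> 3) \<and> padic_unit p (\<tau> 4)"
  proof (cases "s = 0")
    case True
    then have b: "balanced_values p (\<tau> 1) (\<tau> 2) (\<tau> 3) (\<tau> 4) (\<tau> 0)"
      using assms(2) props(2) unfolding well_balanced_def has_initial_values_def by simp
    then have "\<tau> 5 = (\<tau> 4 * \<tau> 1 + \<tau> 3 * \<tau> 2) / \<tau> 0"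
      using r unfolding balanced_values_def by (simp add: field_simps)
    then show ?thesis
      using b u padic_abs_le_1_iff[OF p] padic_abs_le_imp_padic_int[OF p]
      unfolding balanced_values_def by simp
  next
    case False
    then have b: "balanced_values p (\<tau> 1) (\<tau> 2) (\<tau> 3) (\<tau> 4) (\<tau> 5)"
      using assms(2) props(2) unfolding well_balanced_def has_initial_values_def by simp
    then have "\<tau> 0 = (\<tau> 4 * \<tau> 1 + \<tau> 3 * \<tau> 2) / \<tau> 5"
      using r unfolding balanced_values_def by (simp add: field_simps)
    then show ?thesis
      using b u padic_abs_le_1_iff[OF p] padic_abs_le_imp_padic_int[OF p]
      unfolding balanced_values_def by simp
  qed
  then have "window_cong p \<tau> 0 0"
    unfolding window_cong_def[OF p] padic_cong_refl[OF p] by (simp add: padic_unit_def)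
  then show ?thesis
    using window_cong_periodic[OF p props(1,3,4)] props(1,2) somos5_laurent_ex1 padic_abs_le_1_iff[OF p]
    unfolding \<tau>_def by blast
qed

end
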